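(* For every $n\geq 1$, the sequence $J_{2n,1},J_{2n,2},\ldots,J_{2n,2n-1}$ is unimodal, i.e., there is an index $j$ with $J_{2n,1}\leq\cdots\leq J_{2n,j}\geq J_{2n,j+1}\geq\cdots\geq J_{2n,2n-1}$.
   Context: For a permutation $\pi=a_1a_2\cdots a_m$ of $[m]=\{1,\ldots,m\}$, a descent is an index $1\leq i\leq m-1$ with $a_i>a_{i+1}$. A fixed-point free involution of $[m]$ is a permutation $\pi$ with $\pi^2=\mathrm{id}$ and $\pi(i)\neq i$ for all $i$. $J_{m,j}$ denotes the number of fixed-point free involutions of $[m]$ with exactly $j$ descents. *)

theory Defs
  imports "HOL-Combinatorics.Permutations"
begin

definition descents :: "nat \<Rightarrow> (nat \<Rightarrow> nat) \<Rightarrow> nat set" where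
  "descents m p = {i \<in> {1..m-1}. p i > p (Suc i)}"

definition fpf_involution :: "nat \<Rightarrow> (nat \<Rightarrow> nat) \<Rightarrow> bool" where
  "fpf_involution m p \<longleftrightarrow> p permutes {1..m} \<and> p \<circ> p = id \<and> (\<forall>i\<in>{1..m}. p i \<noteq> i)"

definition J :: "nat \<Rightarrow> nat \<Rightarrow> nat" where
  "J m j = card {p. fpf_involution m p \<and> card (descents m p) = j}"

end

theory Submission
  imports Defs "HOL-Library.Product_Lexorder"
begin

text \<open>
  Pair a fixed-point free involution \<open>p\<close> of \<open>{1..2n}\<close> with a weakly increasing
  \<open>f : {1..2n} \<rightarrow> {0..<r}\<close> that increases strictly at the descents of \<open>p\<close>. The multiset of the
  pairs \<open>(f i, f (p i))\<close> with \<open>f i < f (p i)\<close> determines \<open>(p, f)\<close>, and every multiset of \<open>n\<close>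
  edges of the complete graph on \<open>r\<close> vertices arises, since \<open>p\<close> can be recovered by stable sorting.
  Counting both sides gives
  \<open>\<Sum>k. J(2n, k) * (r + 2n - 1 - k choose 2n) = ((r choose 2) + n - 1 choose n)\<close> for all \<open>r\<close>.
  Multiplying the identity for \<open>n - 1\<close> by \<open>r (r - 1) + 2n - 2\<close> and comparing coefficients yields
  \<open>2n J(2n, k) = (k (k + 1) + 2n - 2) J(2n - 2, k) + 2 ((k - 1) (2n - k - 1) + 1) J(2n - 2, k - 1)
  + ((2n - k) (2n - k + 1) + 2n - 2) J(2n - 2, k - 2)\<close>. By induction on \<open>n\<close>, the sequence is
  symmetric about \<open>n\<close> and weakly increasing up to \<open>n\<close>.
\<close>

subsection \<open>Increasing maps, multisets and sorting permutations\<close>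

lemma image_mset_interval_eq_mset_map:
  "image_mset k (mset_set {1..m}) = mset (map k [1..<Suc m])"
  by (simp add: atLeastLessThanSuc_atLeastAtMost del: upt_Suc)

lemma mono_on_key_exists:
  fixes S :: "'a::linorder multiset"
  assumes "size S = m"
  obtains k where "mono_on {1..m} k" "image_mset k (mset_set {1..m}) = S"
proof
  define L where "L = sorted_list_of_multiset S"
  let ?k = "\<lambda>i. L ! (i - 1)"
  have len: "length L = m"
    unfolding L_def using assms by (metis mset_sorted_list_of_multiset size_mset)
  have "sorted L" by (simp add: L_def)
  then show "mono_on {1..m} ?k"
    by (intro mono_onI sorted_nth_mono) (auto simp: len)
  have "map ?k [1..<Suc m] = L"
    by (intro nth_equalityI) (auto simp: len simp del: upt_Suc)
  then show "image_mset ?k (mset_set {1..m}) = S"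
    unfolding image_mset_interval_eq_mset_map by (simp add: L_def)
qed

text \<open>Such a map lists the multiset in sorted order, and that list is unique. Used both for
  numbers and for pairs in lexicographic order.\<close>

lemma mono_on_key_unique:
  fixes k l :: "nat \<Rightarrow> 'a::linorder"
  assumes "mono_on {1..m} k" "mono_on {1..m} l"
    and "image_mset k (mset_set {1..m}) = image_mset l (mset_set {1..m})"
    and "i \<in> {1..m}"
  shows "k i = l i"
proof -
  have sorted: "sorted (map h [1..<Suc m])" if "mono_on {1..m} h" for h :: "nat \<Rightarrow> 'a"
    using that by (auto simp: sorted_iff_nth_mono mono_on_def simp del: upt_Suc)
  have "map k [1..<Suc m] = map l [1..<Suc m]"
    using assms(3) unfolding image_mset_interval_eq_mset_map
    by (metis sorted assms(1,2) properties_for_sort)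
  then show ?thesis using assms(4) by (auto simp del: upt_Suc)
qed

text \<open>\<open>p\<close> and \<open>id\<close> are both increasing enumerations of
  \<open>{1..m}\<close>.\<close>

lemma permutes_strict_mono_on_id:
  fixes p :: "nat \<Rightarrow> nat"
  assumes "p permutes {1..m}" "strict_mono_on {1..m} p"
  shows "p = id"
proof
  fix i
  have "image_mset p (mset_set {1..m}) = image_mset id (mset_set {1..m})"
    using assms(1) by (simp add: image_mset_mset_set permutes_inj_on permutes_image)
  moreover have "mono_on {1..m} p" "mono_on {1..m} id"
    using strict_mono_on_imp_mono_on[OF assms(2)] by (auto intro: mono_onI)
  ultimately show "p i = id i"
    using mono_on_key_unique[of m p id i] permutes_not_in[OF assms(1), of i] by fastforce
qed

text \<open>\<open>p i\<close> is the rank of \<open>h i\<close> among the keys. If the position is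
  the second component of the key, \<open>p\<close> is a stable sort.\<close>

lemma rank_permutation:
  fixes h :: "nat \<Rightarrow> 'a::linorder"
  assumes "inj_on h {1..m}"
  obtains p where "p permutes {1..m}"
    "\<And>i j. i \<in> {1..m} \<Longrightarrow> j \<in> {1..m} \<Longrightarrow> p i < p j \<longleftrightarrow> h i < h j"
proof
  define R where "R i = {j \<in> {1..m}. h j \<le> h i}" for i
  define p where "p i = (if i \<in> {1..m} then card (R i) else i)" for i
  have less: "p i < p j" if "i \<in> {1..m}" "j \<in> {1..m}" "h i < h j" for i j
  proof -
    have "R i \<subseteq> R j" "j \<in> R j" "j \<notin> R i" using that by (auto simp: R_def)
    then have "R i \<subset> R j" by blast
    moreover have "finite (R j)" by (simp add: R_def)
    ultimately show ?thesis using that by (simp add: p_def psubset_card_mono)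
  qed
  have neq: "h i \<noteq> h j" if "i \<in> {1..m}" "j \<in> {1..m}" "i \<noteq> j" for i j
    using assms that by (meson inj_onD)
  show "p i < p j \<longleftrightarrow> h i < h j" if "i \<in> {1..m}" "j \<in> {1..m}" for i j
    using less[of i j] less[of j i] neq[of i j] that
    by (cases "i = j") (auto dest: less_asym simp: neq_iff)
  have inj: "inj_on p {1..m}"
  proof (rule inj_onI, rule ccontr)
    fix i j assume "i \<in> {1..m}" "j \<in> {1..m}" "p i = p j" "i \<noteq> j"
    moreover from this have "h i \<noteq> h j" by (intro neq)
    then have "h i < h j \<or> h j < h i" by (simp add: neq_iff)
    ultimately show False using less[of i j] less[of j i] by auto
  qed
  have "p i \<in> {1..m}" if "i \<in> {1..m}" for i
  proof -
    have "card {i} \<le> card (R i)" using that by (intro card_mono) (auto simp: R_def)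
    moreover have "card (R i) \<le> card {1..m}" by (intro card_mono) (auto simp: R_def)
    ultimately show ?thesis using that by (simp add: p_def)
  qed
  then have "p ` {1..m} \<subseteq> {1..m}" by blast
  with inj have "p ` {1..m} = {1..m}" by (intro endo_inj_surj) simp_all
  then show "p permutes {1..m}"
    using inj by (intro bij_imp_permutes) (auto simp: bij_betw_def p_def)
qed

subsection \<open>Maps compatible with a descent set\<close>

text \<open>For \<open>r > 0\<close> these are ways to place \<open>r - 1\<close> bars,
  \<open>f i\<close> being the number of bars before position \<open>i\<close>, with at least one
  bar right after each index in \<open>D\<close>.\<close>

definition compatible :: "nat \<Rightarrow> nat \<Rightarrow> nat set \<Rightarrow> (nat \<Rightarrow> nat) set" where
  "compatible m r D = {f \<in> {1..m} \<rightarrow>\<^sub>E {..<r}. mono_on {1..m} f \<and> (\<forall>i\<in>D. f i < f (Suc i))}"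

lemma mono_on_atLeastAtMostI:
  fixes f :: "nat \<Rightarrow> 'a::order"
  assumes "\<And>i. a \<le> i \<Longrightarrow> i < b \<Longrightarrow> f i \<le> f (Suc i)"
  shows "mono_on {a..b} f"
proof (rule mono_onI)
  fix i j assume "i \<in> {a..b}" "j \<in> {a..b}" "i \<le> j"
  from this(3,1,2) show "f i \<le> f j"
  proof (induction rule: dec_induct)
    case (step k)
    then show ?case using assms[of k] by (auto intro: order.trans[of _ "f k"])
  qed simp
qed

lemma card_compatible:
  assumes D: "D \<subseteq> {1..m-1}" and m: "m \<ge> 1"
  shows "card (compatible m r D) = (r + m - 1 - card D) choose m"
proof -
  define c where "c i = card ({1..<i} - D)" for i
  define N where "N = r + m - 1 - card D"
  have c1: "c (Suc i) = c i + (if i \<in> D then 0 else 1)" if "1 \<le> i" for i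
    using that by (auto simp: c_def atLeastLessThanSuc insert_Diff_if)
  have cm: "c m = m - 1 - card D"
  proof -
    have "{1..<m} = {1..m-1}" using m by auto
    then show ?thesis using D by (simp add: c_def card_Diff_subset finite_subset)
  qed
  have cD: "card D \<le> m - 1" using card_mono[OF _ D] by simp
  let ?S = "{A. A \<subseteq> {..<N} \<and> card A = m}"
  \<comment> \<open>Adding the number of weak steps before \<open>i\<close> makes every step strict, so \<open>f\<close> becomes an
    \<open>m\<close>-subset of \<open>{..<N}\<close>.\<close>
  let ?\<Phi> = "\<lambda>f. (\<lambda>i. f i + c i) ` {1..m}"
  have fstep: "f i + c i < f (Suc i) + c (Suc i)"
    if "f \<in> compatible m r D" "1 \<le> i" "i < m" for f i
  proof -
    have "f i \<le> f (Suc i)" "i \<in> D \<Longrightarrow> f i < f (Suc i)"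
      using that by (auto simp: compatible_def mono_on_def)
    then show ?thesis using c1[of i] that by (cases "i \<in> D") simp_all
  qed
  have smono: "strict_mono_on {1..m} (\<lambda>i. f i + c i)" if "f \<in> compatible m r D" for f
  proof (rule strict_mono_onI)
    fix i j assume "i \<in> {1..m}" "j \<in> {1..m}" "i < j"
    from this(3,1,2) show "f i + c i < f j + c j"
    proof (induction rule: strict_inc_induct)
      case (base i)
      then show ?case using fstep[OF that, of i] by simp
    next
      case (step i)
      then have "f (Suc i) + c (Suc i) < f j + c j" by simp
      moreover have "f i + c i < f (Suc i) + c (Suc i)" using step fstep[OF that, of i] by simp
      ultimately show ?case by simp
    qed
  qed
  have "bij_betw ?\<Phi> (compatible m r D) ?S"
    unfolding bij_betw_def
  proof (intro conjI equalityI subsetI)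
    show "inj_on ?\<Phi> (compatible m r D)"
    proof (rule inj_onI)
      fix f g assume f: "f \<in> compatible m r D" and g: "g \<in> compatible m r D"
        and eq: "?\<Phi> f = ?\<Phi> g"
      \<comment> \<open>By strict monotonicity the shifted values form a set, whose increasing
        enumeration is unique.\<close>
      have img: "image_mset (\<lambda>i. h i + c i) (mset_set {1..m}) = mset_set (?\<Phi> h)"
        if "h \<in> compatible m r D" for h
        using smono[OF that] by (intro image_mset_mset_set strict_mono_on_imp_inj_on)
      have "f i + c i = g i + c i" if "i \<in> {1..m}" for i
        using smono[OF f, THEN strict_mono_on_imp_mono_on]
          smono[OF g, THEN strict_mono_on_imp_mono_on] _ that
        by (rule mono_on_key_unique) (simp only: img[OF f] img[OF g] eq)
      then have fg: "f i = g i" if "i \<in> {1..m}" for i using that by simp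
      have "f \<in> {1..m} \<rightarrow>\<^sub>E {..<r}" "g \<in> {1..m} \<rightarrow>\<^sub>E {..<r}"
        using f g by (simp_all add: compatible_def)
      then show "f = g" using fg by (rule PiE_ext)
    qed
  next
    fix A assume "A \<in> ?\<Phi> ` compatible m r D"
    then obtain f where f: "f \<in> compatible m r D" and A: "A = ?\<Phi> f" by blast
    have "card A = m"
      using strict_mono_on_imp_inj_on[OF smono[OF f]] by (simp add: A card_image)
    \<comment> \<open>The largest shifted value is at most
      \<open>(r - 1) + (m - 1 - card D)\<close>, that is \<open>N - 1\<close>.\<close>
    moreover have "f i + c i < N" if "i \<in> {1..m}" for i
    proof -
      have "f i + c i \<le> f m + c m"
        using mono_onD[OF strict_mono_on_imp_mono_on[OF smono[OF f]], of i m] that m by simp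
      moreover have "f m < r" using f m by (auto simp: compatible_def)
      ultimately show ?thesis using cm cD m by (simp add: N_def)
    qed
    ultimately show "A \<in> ?S" by (auto simp: A)
  next
    fix A assume A: "A \<in> ?S"
    then have fin: "finite A" by (auto intro: finite_subset)
    obtain k where k: "mono_on {1..m} k" and kA: "image_mset k (mset_set {1..m}) = mset_set A"
      using mono_on_key_exists[of "mset_set A" m] A by auto
    have img: "k ` {1..m} = A"
      using arg_cong[OF kA, of set_mset] fin by simp
    have inj: "inj_on k {1..m}"
      using img A by (intro eq_card_imp_inj_on) auto
    have less: "k i < k (Suc i)" if "1 \<le> i" "i < m" for i
      using mono_onD[OF k, of i "Suc i"] inj_onD[OF inj, of i "Suc i"] that
      by (simp add: order.strict_iff_order) fastforce
    \<comment> \<open>This keeps the natural subtraction \<open>k i - c i\<close> from truncating: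
      \<open>c\<close> starts at 0 and grows by at most 1 per step, while \<open>k\<close> is
      strictly increasing.\<close>
    have kc: "k i \<ge> c i" if "1 \<le> i" "i \<le> m" for i
      using that
    proof (induction i rule: dec_induct)
      case (step i)
      then show ?case using c1[of i] less[of i] by auto
    qed (simp add: c_def)
    let ?f = "restrict (\<lambda>i. k i - c i) {1..m}"
    have kstep: "?f i \<le> ?f (Suc i)" "i \<in> D \<Longrightarrow> ?f i < ?f (Suc i)" if "1 \<le> i" "i < m" for i
      using that kc[of i] kc[of "Suc i"] c1[of i] less[of i] by (auto split: if_splits)
    have mono: "mono_on {1..m} ?f" by (intro mono_on_atLeastAtMostI kstep)
    have "?f m < r"
    proof -
      have "k m \<in> k ` {1..m}" using m by simp
      then have "k m < N" using A unfolding img by auto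
      then have "k m - c m < r" using kc[of m] cm cD m unfolding N_def by linarith
      then show ?thesis using m by simp
    qed
    then have "?f i < r" if "i \<in> {1..m}" for i
      using mono_onD[OF mono, of i m] that m by (simp del: restrict_apply)
    then have "?f \<in> {1..m} \<rightarrow>\<^sub>E {..<r}" by auto
    moreover have "?f i < ?f (Suc i)" if "i \<in> D" for i
      using subsetD[OF D that] that m by (intro kstep(2)) auto
    ultimately have comp: "?f \<in> compatible m r D" using mono unfolding compatible_def by blast
    have "?\<Phi> ?f = k ` {1..m}" by (rule image_cong[OF refl]) (use kc in simp)
    then show "A \<in> ?\<Phi> ` compatible m r D"
      using imageI[OF comp, of ?\<Phi>] unfolding img by (simp only:)
  qed
  then show ?thesis
    by (simp add: bij_betw_same_card n_subsets N_def)
qed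

text \<open>Without a descent inside a block of equal values of \<open>f\<close>, \<open>p\<close>
  increases on the whole block. The condition on fibres no longer mentions adjacent positions, which
  fits stable sorting.\<close>

lemma compatible_descents_iff:
  assumes p: "p permutes {1..m}"
  shows "f \<in> compatible m r (descents m p) \<longleftrightarrow>
    f \<in> {1..m} \<rightarrow>\<^sub>E {..<r} \<and> mono_on {1..m} f \<and>
    (\<forall>i\<in>{1..m}. \<forall>j\<in>{1..m}. i < j \<longrightarrow> f i = f j \<longrightarrow> p i < p j)"
    (is "_ \<longleftrightarrow> ?range \<and> ?mono \<and> ?fibre")
proof
  assume f: "f \<in> compatible m r (descents m p)"
  then have mono: ?mono and ?range
    and strict: "\<And>i. i \<in> {1..m-1} \<Longrightarrow> p i > p (Suc i) \<Longrightarrow> f i < f (Suc i)"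
    by (simp_all add: compatible_def descents_def)
  have step: "p k < p (Suc k)" if "1 \<le> k" "k < m" "f k = f (Suc k)" for k
  proof -
    have "p k \<noteq> p (Suc k)" using permutes_inj[OF p] by (metis injD n_not_Suc_n)
    moreover have "k \<in> {1..m-1}" using that by auto
    then have "\<not> p (Suc k) < p k" using strict[of k] that(3) by auto
    ultimately show ?thesis by simp
  qed
  have ?fibre
  proof (intro ballI impI)
    fix i j assume "i \<in> {1..m}" "j \<in> {1..m}" "i < j" "f i = f j"
    from this(3,1,2,4) show "p i < p j"
    proof (induction rule: strict_inc_induct)
      case (base i)
      then show ?case using step[of i] by simp
    next
      case (step i)
      have "f i \<le> f (Suc i)" "f (Suc i) \<le> f j"
        using mono_onD[OF mono, of i "Suc i"] mono_onD[OF mono, of "Suc i" j] step by auto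
      then have "f i = f (Suc i)" "f (Suc i) = f j" using step.prems by simp_all
      moreover from this have "p (Suc i) < p j" using step by simp
      moreover have "1 \<le> i" "i < m" using step by simp_all
      ultimately show ?case using \<open>\<And>k. _ \<Longrightarrow> _ \<Longrightarrow> _ \<Longrightarrow> p k < p (Suc k)\<close>[of i] by simp
    qed
  qed
  with mono \<open>?range\<close> show "?range \<and> ?mono \<and> ?fibre" by blast
next
  assume *: "?range \<and> ?mono \<and> ?fibre"
  have "f i < f (Suc i)" if "i \<in> descents m p" for i
  proof -
    have i: "i \<in> {1..m}" "Suc i \<in> {1..m}" "p (Suc i) < p i"
      using that by (auto simp: descents_def)
    then have "f i \<le> f (Suc i)" using * mono_onD[of "{1..m}" f i "Suc i"] by simp
    moreover have "f i \<noteq> f (Suc i)" using * i by (meson lessI less_asym)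
    ultimately show ?thesis by simp
  qed
  with * show "f \<in> compatible m r (descents m p)" by (simp add: compatible_def)
qed

subsection \<open>Involutions and multisets of edges\<close>

text \<open>Swapping exchanges the parts above and below the diagonal, and nothing lies on
  it.\<close>

lemma symmetric_mset_eq:
  fixes K :: "('a::linorder \<times> 'a) multiset"
  assumes swap: "image_mset prod.swap K = K" and diag: "\<And>a. (a, a) \<notin># K"
  shows "K = {#x \<in># K. fst x < snd x#} + image_mset prod.swap {#x \<in># K. fst x < snd x#}"
proof -
  have "image_mset prod.swap {#x \<in># K. fst x < snd x#} =
      {#x \<in># image_mset prod.swap K. snd x < fst x#}"
    by (simp add: filter_mset_image_mset)
  also have "\<dots> = {#x \<in># K. \<not> fst x < snd x#}"
    unfolding swap
  proof (rule filter_mset_cong[OF refl])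
    fix x assume "x \<in># K"
    then have "fst x \<noteq> snd x" using diag[of "fst x"] by (metis prod.collapse)
    then show "snd x < fst x \<longleftrightarrow> \<not> fst x < snd x" by auto
  qed
  finally show ?thesis using multiset_partition[of K "\<lambda>x. fst x < snd x"] by simp
qed

definition pair_mset :: "nat \<Rightarrow> (nat \<Rightarrow> nat) \<Rightarrow> (nat \<Rightarrow> nat) \<Rightarrow> (nat \<times> nat) multiset" where
  "pair_mset m p f = image_mset (\<lambda>i. (f i, f (p i))) (mset_set {1..m})"

text \<open>For compatible \<open>f\<close>, each 2-cycle of a fixed-point free involution
  \<open>p\<close> yields a pair and its swap; keeping the increasing one gives one edge per
  cycle.\<close>

definition edge_mset :: "nat \<Rightarrow> (nat \<Rightarrow> nat) \<Rightarrow> (nat \<Rightarrow> nat) \<Rightarrow> (nat \<times> nat) multiset" where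
  "edge_mset m p f = {#x \<in># pair_mset m p f. fst x < snd x#}"

lemma image_mset_permutes: "p permutes A \<Longrightarrow> image_mset p (mset_set A) = mset_set A"
  by (simp add: image_mset_mset_set permutes_inj_on permutes_image)

text \<open>If \<open>f i = f (p i)\<close>, then \<open>p\<close> would preserve the order of
  \<open>i\<close> and \<open>p i\<close>, yet it exchanges them; so no pair is diagonal. The last
  claim says that \<open>p\<close> is the stable sort of the positions by
  \<open>f (p i)\<close>.\<close>

lemma compatible_props:
  assumes p: "fpf_involution m p" and f: "f \<in> compatible m r (descents m p)"
  shows pair_mset_eq: "pair_mset m p f = edge_mset m p f + image_mset prod.swap (edge_mset m p f)"
    and pair_key_mono: "mono_on {1..m} (\<lambda>i. (f i, f (p i)))"
    and perm_less_iff: "i \<in> {1..m} \<Longrightarrow> j \<in> {1..m} \<Longrightarrow>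
      p i < p j \<longleftrightarrow> f (p i) < f (p j) \<or> f (p i) = f (p j) \<and> i < j"
proof -
  have perm: "p permutes {1..m}" and invol: "\<And>i. p (p i) = i" and fpf: "\<And>i. i \<in> {1..m} \<Longrightarrow> p i \<noteq> i"
    using p by (auto simp: fpf_involution_def fun_eq_iff)
  have pin: "p i \<in> {1..m}" if "i \<in> {1..m}" for i
    using that permutes_in_image[OF perm] by blast
  have mono: "\<And>i j. i \<in> {1..m} \<Longrightarrow> j \<in> {1..m} \<Longrightarrow> i \<le> j \<Longrightarrow> f i \<le> f j"
    and fibre: "\<And>i j. i \<in> {1..m} \<Longrightarrow> j \<in> {1..m} \<Longrightarrow> i < j \<Longrightarrow> f i = f j \<Longrightarrow> p i < p j"
    using f unfolding compatible_descents_iff[OF perm] by (blast dest: mono_onD)+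
  have neq: "f i \<noteq> f (p i)" if "i \<in> {1..m}" for i
  proof
    assume "f i = f (p i)"
    then show False
      using fibre[of i "p i"] fibre[of "p i" i] that pin[OF that] fpf[OF that]
      by (metis invol linorder_neqE_nat less_asym)
  qed
  show "mono_on {1..m} (\<lambda>i. (f i, f (p i)))"
  proof (rule mono_onI)
    fix i j assume ij: "i \<in> {1..m}" "j \<in> {1..m}" "i \<le> j"
    show "(f i, f (p i)) \<le> (f j, f (p j))"
    proof (cases "f i = f j")
      case True
      then have "p i \<le> p j" using fibre[of i j] ij by (cases "i = j") auto
      then show ?thesis using True mono pin ij by simp
    next
      case False
      then show ?thesis using mono[OF ij] by simp
    qed
  qed
  have fwd: "f (p i) < f (p j) \<or> f (p i) = f (p j) \<and> i < j"
    if "i \<in> {1..m}" "j \<in> {1..m}" "p i < p j" for i j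
    using mono[of "p i" "p j"] fibre[of "p i" "p j"] that pin invol by (auto simp: le_less)
  show "p i < p j \<longleftrightarrow> f (p i) < f (p j) \<or> f (p i) = f (p j) \<and> i < j"
    if "i \<in> {1..m}" "j \<in> {1..m}"
    using fwd[of i j] fwd[of j i] that permutes_inj[OF perm]
    by (metis injD less_asym less_irrefl linorder_neqE_nat)
  \<comment> \<open>Swapping the pairs amounts to reindexing by the involution
    \<open>p\<close>.\<close>
  have "image_mset prod.swap (pair_mset m p f) = image_mset (\<lambda>i. (f i, f (p i))) (image_mset p (mset_set {1..m}))"
    by (simp add: pair_mset_def multiset.map_comp comp_def invol)
  then have "image_mset prod.swap (pair_mset m p f) = pair_mset m p f"
    by (simp only: image_mset_permutes[OF perm] pair_mset_def)
  moreover have "(a, a) \<notin># pair_mset m p f" for a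
    using neq by (force simp: pair_mset_def)
  ultimately show "pair_mset m p f = edge_mset m p f + image_mset prod.swap (edge_mset m p f)"
    unfolding edge_mset_def by (rule symmetric_mset_eq)
qed

text \<open>The edges and their swaps, sorted lexicographically, recover
  \<open>(f i, f (p i))\<close> for every \<open>i\<close>; by \<open>perm_less_iff\<close> these
  keys fix the relative order of the values of the permutation.\<close>

lemma edge_mset_inj:
  assumes p: "fpf_involution m p" and f: "f \<in> compatible m r (descents m p)"
    and q: "fpf_involution m q" and g: "g \<in> compatible m r (descents m q)"
    and eq: "edge_mset m p f = edge_mset m q g"
  shows "p = q \<and> f = g"
proof -
  have perm: "p permutes {1..m}" "q permutes {1..m}" and invol: "\<And>i. p (p i) = i"
    using p q by (auto simp: fpf_involution_def fun_eq_iff)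
  have "pair_mset m p f = pair_mset m q g"
    using pair_mset_eq[OF p f] pair_mset_eq[OF q g] eq by simp
  then have keys: "(f i, f (p i)) = (g i, g (q i))" if "i \<in> {1..m}" for i
    using mono_on_key_unique[OF pair_key_mono[OF p f] pair_key_mono[OF q g] _ that]
    by (simp add: pair_mset_def)
  have less: "q i < q j \<longleftrightarrow> p i < p j" if "i \<in> {1..m}" "j \<in> {1..m}" for i j
    using perm_less_iff[OF p f that] perm_less_iff[OF q g that] keys that by simp
  have "strict_mono_on {1..m} (q \<circ> p)"
  proof (rule strict_mono_onI)
    fix i j assume "i \<in> {1..m}" "j \<in> {1..m}" "i < j"
    then show "(q \<circ> p) i < (q \<circ> p) j"
      using less[of "p i" "p j"] permutes_in_image[OF perm(1)] by (simp add: invol)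
  qed
  then have "q \<circ> p = id"
    using perm by (intro permutes_strict_mono_on_id permutes_compose)
  then have "q (p (p i)) = p i" for i by (metis comp_apply id_apply)
  then have "p = q" by (simp add: invol fun_eq_iff)
  moreover have "f \<in> {1..m} \<rightarrow>\<^sub>E {..<r}" "g \<in> {1..m} \<rightarrow>\<^sub>E {..<r}"
    using f g by (simp_all add: compatible_def)
  then have "f = g" by (rule PiE_ext) (use keys in simp)
  ultimately show ?thesis by blast
qed

text \<open>The inverse construction: \<open>k\<close> lists \<open>M\<close> and its swaps in
  lexicographic order, and \<open>f\<close> consists of the first components.\<close>

lemma edge_mset_surj:
  assumes M: "M \<in> multisets_of_size {(a, b). a < b \<and> b < r} n"
  obtains p f where "fpf_involution (2 * n) p" "f \<in> compatible (2 * n) r (descents (2 * n) p)"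
    "edge_mset (2 * n) p f = M"
proof -
  define m where "m = 2 * n"
  define S where "S = M + image_mset prod.swap M"
  have MS: "fst x < snd x \<and> snd x < r" if "x \<in># M" for x
    using multisets_of_size_subset[OF M] that by auto
  have SS: "fst x \<noteq> snd x \<and> fst x < r" if "x \<in># S" for x
  proof -
    have "x \<in># M \<or> prod.swap x \<in># M" using that by (auto simp: S_def)
    then show ?thesis using MS[of x] MS[of "prod.swap x"] by auto
  qed
  have swapS: "image_mset prod.swap S = S"
    by (simp add: S_def multiset.map_comp comp_def add.commute)
  have filterS: "{#x \<in># S. fst x < snd x#} = M"
  proof -
    have "{#x \<in># M. fst x < snd x#} = M" using MS by (simp add: filter_mset_eq_conv)
    moreover have "{#x \<in># M. snd x < fst x#} = {#}" using MS by (force simp: filter_mset_eq_conv)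
    ultimately show ?thesis by (simp add: S_def filter_mset_image_mset)
  qed
  have "size S = m" using multisets_of_size_size[OF M] by (simp add: S_def m_def)
  then obtain k where k: "mono_on {1..m} k" and kS: "image_mset k (mset_set {1..m}) = S"
    by (rule mono_on_key_exists)
  have kin: "k i \<in># S" if "i \<in> {1..m}" for i
    using that unfolding kS[symmetric] by simp
  \<comment> \<open>The involution is the stable sort by the second components: sorting the swapped pairs
    gives back the same list because \<open>S\<close> is invariant under swapping.\<close>
  have inj: "inj_on (\<lambda>i. (snd (k i), i)) {1..m}" by (simp add: inj_on_def)
  obtain p where perm: "p permutes {1..m}"
    and p_less: "\<And>i j. i \<in> {1..m} \<Longrightarrow> j \<in> {1..m} \<Longrightarrow>
      p i < p j \<longleftrightarrow> (snd (k i), i) < (snd (k j), j)"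
    using rank_permutation[OF inj] by metis
  have pin: "p i \<in> {1..m}" if "i \<in> {1..m}" for i
    using that permutes_in_image[OF perm] by blast
  have k_le: "fst (k i) < fst (k j) \<or> fst (k i) = fst (k j) \<and> snd (k i) \<le> snd (k j)"
    if "i \<in> {1..m}" "j \<in> {1..m}" "i \<le> j" for i j
    using mono_onD[OF k that] by (auto simp: less_eq_prod_def)
  have fibre: "p i < p j"
    if "i \<in> {1..m}" "j \<in> {1..m}" "i < j" "fst (k i) = fst (k j)" for i j
    using k_le[of i j] that by (auto simp: p_less)
  let ?k' = "\<lambda>i. prod.swap (k (inv p i))"
  \<comment> \<open>Ties in the second component stay in order of position, along which the first
    components increase, so the swapped list is sorted.\<close>
  have mono': "mono_on {1..m} ?k'"
  proof (rule mono_onI)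
    fix i j assume ij: "i \<in> {1..m}" "j \<in> {1..m}" "i \<le> j"
    define a b where "a = inv p i" and "b = inv p j"
    have ab: "a \<in> {1..m}" "b \<in> {1..m}" "p a = i" "p b = j"
      using ij permutes_in_image[OF permutes_inv[OF perm]] permutes_inverses(1)[OF perm]
      by (simp_all add: a_def b_def)
    show "?k' i \<le> ?k' j"
    proof (cases "i = j")
      case False
      then have "(snd (k a), a) < (snd (k b), b)" using p_less[OF ab(1,2)] ab ij by simp
      then have "snd (k a) < snd (k b) \<or> snd (k a) = snd (k b) \<and> a < b" by auto
      then show ?thesis
        using k_le[OF ab(1,2)] by (auto simp: less_eq_prod_def simp flip: a_def b_def)
    qed simp
  qed
  have "image_mset ?k' (mset_set {1..m}) =
      image_mset prod.swap (image_mset k (image_mset (inv p) (mset_set {1..m})))"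
    by (simp add: multiset.map_comp comp_def)
  also have "\<dots> = image_mset k (mset_set {1..m})"
    by (simp only: image_mset_permutes[OF permutes_inv[OF perm]] kS swapS)
  finally have k': "prod.swap (k (inv p i)) = k i" if "i \<in> {1..m}" for i
    using mono_on_key_unique[OF mono' k _ that] by simp
  have kp: "k (p i) = prod.swap (k i)" if "i \<in> {1..m}" for i
    using k'[OF pin[OF that]] by (simp add: permutes_inverses(2)[OF perm])
  \<comment> \<open>As \<open>snd (k (p i)) = fst (k i)\<close>, the sorting key of
    \<open>p i\<close> is \<open>(fst (k i), p i)\<close>. It increases with \<open>i\<close>, since
    \<open>p\<close> increases wherever \<open>fst (k i)\<close> is constant.\<close>
  have "strict_mono_on {1..m} (p \<circ> p)"
  proof (rule strict_mono_onI)
    fix i j assume ij: "i \<in> {1..m}" "j \<in> {1..m}" "i < j"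
    then have "(fst (k i), p i) < (fst (k j), p j)"
      using k_le[of i j] fibre[of i j] by auto
    then show "(p \<circ> p) i < (p \<circ> p) j" using p_less[of "p i" "p j"] pin ij by (simp add: kp)
  qed
  then have "p \<circ> p = id"
    using perm by (intro permutes_strict_mono_on_id permutes_compose)
  moreover have "p i \<noteq> i" if "i \<in> {1..m}" for i
    using kp[OF that] SS[OF kin[OF that]] by (metis fst_swap)
  ultimately have fpf: "fpf_involution m p" using perm by (simp add: fpf_involution_def)
  define f where "f = restrict (fst \<circ> k) {1..m}"
  have "f \<in> {1..m} \<rightarrow>\<^sub>E {..<r}" using SS kin by (auto simp: f_def)
  moreover have "mono_on {1..m} f"
  proof (rule mono_onI)
    fix i j assume "i \<in> {1..m}" "j \<in> {1..m}" "i \<le> j"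
    then show "f i \<le> f j" using k_le[of i j] by (auto simp: f_def)
  qed
  moreover have "\<forall>i\<in>{1..m}. \<forall>j\<in>{1..m}. i < j \<longrightarrow> f i = f j \<longrightarrow> p i < p j"
    using fibre by (simp add: f_def)
  ultimately have comp: "f \<in> compatible m r (descents m p)"
    by (simp add: compatible_descents_iff[OF perm])
  have "pair_mset m p f = image_mset k (mset_set {1..m})"
    unfolding pair_mset_def
  proof (rule image_mset_cong)
    fix i assume "i \<in># mset_set {1..m}"
    then have i: "i \<in> {1..m}" by simp
    then show "(f i, f (p i)) = k i" using pin[OF i] kp[OF i] by (simp add: f_def)
  qed
  then have "edge_mset m p f = M" by (simp only: edge_mset_def kS filterS)
  with fpf comp show ?thesis using that by (simp add: m_def)
qed

section \<open>Double counting of the pairs of an involution and a compatible map\<close>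

lemma card_edges: "card {(a, b). a < b \<and> b < (r::nat)} = r choose 2"
proof -
  have "{(a, b). a < b \<and> b < r} = prod.swap ` (SIGMA b:{..<r}. {..<b})" by auto
  then have "card {(a, b). a < b \<and> b < r} = (\<Sum>b<r. b)"
    by (simp add: card_image)
  also have "\<dots> = r choose 2" by (induction r) (simp_all add: numeral_2_eq_2)
  finally show ?thesis .
qed

lemma card_pairs:
  "card (SIGMA p:{p. fpf_involution (2 * n) p}. compatible (2 * n) r (descents (2 * n) p)) =
    (r choose 2) + n - 1 choose n"
proof -
  let ?P = "SIGMA p:{p. fpf_involution (2 * n) p}. compatible (2 * n) r (descents (2 * n) p)"
  let ?E = "{(a, b). a < b \<and> b < r}"
  have "bij_betw (\<lambda>(p, f). edge_mset (2 * n) p f) ?P (multisets_of_size ?E n)"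
    unfolding bij_betw_def
  proof (intro conjI equalityI subsetI)
    show "inj_on (\<lambda>(p, f). edge_mset (2 * n) p f) ?P"
      by (rule inj_onI) (use edge_mset_inj in \<open>fastforce split: prod.splits\<close>)
  next
    fix M assume "M \<in> (\<lambda>(p, f). edge_mset (2 * n) p f) ` ?P"
    then obtain p f where p: "fpf_involution (2 * n) p"
      and f: "f \<in> compatible (2 * n) r (descents (2 * n) p)" and M: "M = edge_mset (2 * n) p f"
      by auto
    \<comment> \<open>Each edge accounts for two of the \<open>2 * n\<close> pairs.\<close>
    have "size (pair_mset (2 * n) p f) = 2 * size M"
      using pair_mset_eq[OF p f] by (simp add: M)
    then have "size M = n" by (simp add: pair_mset_def)
    moreover have "p i \<in> {1..2 * n}" if "i \<in> {1..2 * n}" for i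
      using p that permutes_in_image unfolding fpf_involution_def by metis
    then have "set_mset M \<subseteq> ?E"
      using f by (auto simp: M edge_mset_def pair_mset_def compatible_def)
    ultimately show "M \<in> multisets_of_size ?E n" by (simp add: multisets_of_size_def)
  next
    fix M assume "M \<in> multisets_of_size ?E n"
    then obtain p f where "fpf_involution (2 * n) p"
      "f \<in> compatible (2 * n) r (descents (2 * n) p)" "edge_mset (2 * n) p f = M"
      by (rule edge_mset_surj)
    then show "M \<in> (\<lambda>(p, f). edge_mset (2 * n) p f) ` ?P" by force
  qed
  then have "card ?P = card (multisets_of_size ?E n)" by (rule bij_betw_same_card)
  also have "finite ?E" by (rule finite_subset[of _ "{..<r} \<times> {..<r}"]) auto
  then have "card (multisets_of_size ?E n) = card ?E + n - 1 choose n"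
    by (rule card_multisets_of_size)
  finally show ?thesis by (simp only: card_edges)
qed

lemma finite_fpf_involutions: "finite {p. fpf_involution m p}"
  by (rule finite_subset[OF _ finite_permutations[of "{1..m}"]]) (auto simp: fpf_involution_def)

lemma descents_subset: "descents m p \<subseteq> {1..m-1}"
  by (auto simp: descents_def)

lemma J_eq_0:
  assumes "m \<ge> 1" "k \<ge> m"
  shows "J m k = 0"
proof -
  have "card (descents m p) \<le> m - 1" for p
    using card_mono[OF _ descents_subset[of m p]] by simp
  then have "card (descents m p) < k" for p
    by (rule order.strict_trans1) (use assms in simp)
  then have "card (descents m p) \<noteq> k" for p using less_irrefl by metis
  then show ?thesis by (simp add: J_def)
qed

text \<open>Group the pairs of \<open>card_pairs\<close> by the number of descents, on which alone
  the number of compatible maps depends.\<close>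

lemma sum_J:
  assumes "n \<ge> 1"
  shows "(\<Sum>k<2*n. J (2 * n) k * ((r + 2 * n - 1 - k) choose (2 * n))) = (r choose 2) + n - 1 choose n"
proof -
  let ?m = "2 * n" and ?F = "{p. fpf_involution (2 * n) p}"
  let ?w = "\<lambda>k. (r + 2 * n - 1 - k) choose (2 * n)"
  have fin: "finite (compatible ?m r D)" for D
    by (rule finite_subset[of _ "{1..?m} \<rightarrow>\<^sub>E {..<r}"]) (auto simp: compatible_def intro: finite_PiE)
  have range: "(\<lambda>p. card (descents ?m p)) ` ?F \<subseteq> {..<?m}"
  proof
    fix k assume "k \<in> (\<lambda>p. card (descents ?m p)) ` ?F"
    then obtain p where "k = card (descents ?m p)" by blast
    also have "\<dots> \<le> ?m - 1" using card_mono[OF _ descents_subset[of ?m p]] by simp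
    finally show "k \<in> {..<?m}" using assms by simp
  qed
  have "(r choose 2) + n - 1 choose n = (\<Sum>p\<in>?F. ?w (card (descents ?m p)))"
    unfolding card_pairs[symmetric] using assms fin
    by (subst card_SigmaI)
       (auto simp: finite_fpf_involutions card_compatible[OF descents_subset] intro!: sum.cong)
  also have "\<dots> = (\<Sum>k<?m. \<Sum>p\<in>{p \<in> ?F. card (descents ?m p) = k}. ?w (card (descents ?m p)))"
    using range by (intro sum.group[symmetric] finite_fpf_involutions) auto
  also have "\<dots> = (\<Sum>k<?m. J ?m k * ?w k)"
    by (intro sum.cong refl) (simp add: J_def)
  finally show ?thesis by simp
qed

subsection \<open>The recurrence and unimodality\<close>

text \<open>The count from \<open>card_compatible\<close> for \<open>k\<close> descents, moved to
  the integers so that coefficients may involve subtraction.\<close>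

definition ncompat :: "nat \<Rightarrow> nat \<Rightarrow> nat \<Rightarrow> int" where
  "ncompat m r k = int ((r + m - 1 - k) choose m)"

lemma ncompat_eq_0: "m \<ge> 1 \<Longrightarrow> r \<le> k \<Longrightarrow> ncompat m r k = 0"
  unfolding ncompat_def by (subst binomial_eq_0) auto

text \<open>Absorption brings the three binomials to the common factor \<open>C\<close>; multiplying
  by \<open>m * (m - 1)\<close> avoids division.\<close>

lemma binomial_shift:
  fixes m y :: nat
  assumes m: "m \<ge> 2"
  defines "C \<equiv> int ((y + m - 2) choose (m - 2))"
  shows "int m * (int m - 1) * int ((y + m) choose m) = (int y + int m) * (int y + int m - 1) * C"
    and "int m * (int m - 1) * int ((y + m - 1) choose m) = int y * (int y + int m - 1) * C"
    and "int m * (int m - 1) * int ((y + m - 2) choose m) = int y * (int y - 1) * C"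
proof -
  obtain q where q: "m = Suc (Suc q)" using m by (metis add_2_eq_Suc le_Suc_ex)
  have up: "(int N + 1) * int (N choose k) = (int k + 1) * int (Suc N choose Suc k)" for N k
    using arg_cong[OF Suc_times_binomial_eq[of N k], of int] by (simp add: algebra_simps)
  have right: "(int k + 1) * int (N choose Suc k) = (int N - int k) * int (N choose k)" for N k
  proof -
    have "(int k + 1) * (int (N choose k) + int (N choose Suc k)) = (int N + 1) * int (N choose k)"
      using up[of N k] by simp
    then show ?thesis by (simp add: algebra_simps)
  qed
  note e = up[of "y+q" q] up[of "Suc (y+q)" "Suc q"] right[of q "y+q"] right[of "Suc q" "y+q"]
    right[of "Suc q" "Suc (y+q)"]
  show "int m * (int m - 1) * int ((y + m) choose m) = (int y + int m) * (int y + int m - 1) * C"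
    using e(1,2) by (simp add: q C_def) algebra
  show "int m * (int m - 1) * int ((y + m - 1) choose m) = int y * (int y + int m - 1) * C"
    using e(1,5) by (simp add: q C_def del: binomial_Suc_Suc) algebra
  show "int m * (int m - 1) * int ((y + m - 2) choose m) = int y * (int y - 1) * C"
    using e(3,4) by (simp add: q C_def del: binomial_Suc_Suc) algebra
qed

text \<open>For \<open>r > j\<close> put \<open>r = j + y + 1\<close>. By
  \<open>binomial_shift\<close> every term is a polynomial times the same binomial, leaving a
  polynomial identity in \<open>j\<close>, \<open>y\<close> and \<open>m\<close>.\<close>

lemma ncompat_recurrence:
  fixes m r j :: nat
  assumes m: "m \<ge> 3"
  shows "(int r * (int r - 1) + int m - 2) * ncompat (m - 2) r j =
     (int j * (int j + 1) + int m - 2) * ncompat m r j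
   + 2 * (int j * (int m - int j - 2) + 1) * ncompat m r (j + 1)
   + ((int m - int j - 2) * (int m - int j - 1) + int m - 2) * ncompat m r (j + 2)"
proof (cases "r \<le> j")
  case True
  then show ?thesis using m by (simp add: ncompat_eq_0)
next
  case False
  then obtain y where r: "r = Suc (j + y)" using less_imp_Suc_add[of j r] by auto
  let ?C = "int ((y + m - 2) choose (m - 2))"
  have w: "ncompat (m - 2) r j = ?C" "ncompat m r j = int ((y + m) choose m)"
    "ncompat m r (j + 1) = int ((y + m - 1) choose m)" "ncompat m r (j + 2) = int ((y + m - 2) choose m)"
    using m by (simp_all add: ncompat_def r algebra_simps)
  have m2: "m \<ge> 2" using m by simp
  have r': "int r = int j + int y + 1" by (simp add: r)
  have regroup: "M * (\<alpha> * u + \<beta> * v + \<gamma> * w) = \<alpha> * (M * u) + \<beta> * (M * v) + \<gamma> * (M * w)" for M \<alpha> \<beta> \<gamma> u v w :: int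
    by (simp add: algebra_simps)
  have "int m * (int m - 1) * ((int r * (int r - 1) + int m - 2) * ncompat (m - 2) r j) =
    int m * (int m - 1) * ((int j * (int j + 1) + int m - 2) * ncompat m r j
   + 2 * (int j * (int m - int j - 2) + 1) * ncompat m r (j + 1)
   + ((int m - int j - 2) * (int m - int j - 1) + int m - 2) * ncompat m r (j + 2))"
    unfolding regroup w r' binomial_shift[OF m2] by (simp add: algebra_simps)
  moreover have "int m * (int m - 1) \<noteq> 0" using m by auto
  ultimately show ?thesis by (simp only: mult_cancel_left) simp
qed

text \<open>The system is triangular: at \<open>r = k + 1\<close> the terms beyond \<open>k\<close>
  vanish and the \<open>k\<close>-th one has factor \<open>m choose m = 1\<close>.\<close>

lemma ncompat_unique:
  fixes a b :: "nat \<Rightarrow> int"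
  assumes "m \<ge> 1"
    and eq: "\<And>r. (\<Sum>k<K. a k * ncompat m r k) = (\<Sum>k<K. b k * ncompat m r k)"
    and "k < K"
  shows "a k = b k"
  using \<open>k < K\<close>
proof (induction k rule: less_induct)
  case (less k)
  define d where "d i = a i - b i" for i
  have "0 = (\<Sum>i<K. d i * ncompat m (Suc k) i)"
    using eq[of "Suc k"] by (simp add: d_def left_diff_distrib sum_subtractf)
  also have "\<dots> = (\<Sum>i\<in>{k}. d i * ncompat m (Suc k) i)"
  proof (rule sum.mono_neutral_right)
    show "\<forall>i\<in>{..<K} - {k}. d i * ncompat m (Suc k) i = 0"
    proof
      fix i assume i: "i \<in> {..<K} - {k}"
      show "d i * ncompat m (Suc k) i = 0"
      proof (cases "i < k")
        case True
        then show ?thesis using less.IH i by (simp add: d_def)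
      next
        case False
        then show ?thesis using i assms(1) by (simp add: ncompat_eq_0)
      qed
    qed
  qed (use less.prems in auto)
  also have "\<dots> = d k" using assms(1) by (simp add: ncompat_def)
  finally show ?case by (simp add: d_def)
qed

text \<open>Integer indices let the recurrence run past both ends. In the increment of
  \<open>b\<close> only \<open>d 0\<close> can be negative, and only at \<open>k = n\<close>, where
  symmetry gives \<open>d 0 = - d 1\<close>.\<close>

lemma unimodal_step:
  fixes a b :: "int \<Rightarrow> int" and n :: int
  assumes n: "n \<ge> 2"
    and rec: "\<And>k. 2 * n * b k =
       (k * (k + 1) + 2 * n - 2) * a k
     + 2 * ((k - 1) * (2 * n - k - 1) + 1) * a (k - 1)
     + ((2 * n - k) * (2 * n - k + 1) + 2 * n - 2) * a (k - 2)"
    and zero: "\<And>k. k \<le> 0 \<Longrightarrow> a k = 0"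
    and sym: "\<And>k. a (2 * (n - 1) - k) = a k"
    and inc: "\<And>k. k \<le> n - 1 \<Longrightarrow> a (k - 1) \<le> a k"
  shows "k \<le> 0 \<Longrightarrow> b k = 0"
    and "b (2 * n - k) = b k"
    and "k \<le> n \<Longrightarrow> b (k - 1) \<le> b k"
proof -
  show zero': "b k = 0" if "k \<le> 0" for k
    using rec[of k] zero[of k] zero[of "k-1"] zero[of "k-2"] that n by simp
  \<comment> \<open>Reflection \<open>k\<close> to \<open>2 * n - k\<close> exchanges the outer
    coefficients of \<open>rec\<close> and fixes the middle one.\<close>
  have "a (2 * n - k) = a (k - 2)" "a (2 * n - k - 1) = a (k - 1)" "a (2 * n - k - 2) = a k"
    using sym[of "k-2"] sym[of "k-1"] sym[of k] by (simp_all add: algebra_simps)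
  then have "2 * n * b (2 * n - k) = 2 * n * b k"
    unfolding rec by (simp add: algebra_simps)
  then show "b (2 * n - k) = b k" using n by simp
  show "b (k - 1) \<le> b k" if k: "k \<le> n"
  proof (cases "k \<le> 0")
    case True
    then show ?thesis using zero'[of k] zero'[of "k-1"] by simp
  next
    case False
    define d where "d i = a (k - i) - a (k - i - 1)" for i
    \<comment> \<open>Summation by parts: the three coefficients in \<open>rec\<close> add up to \<open>4 * n\<^sup>2 + 2 * n\<close>,
      independently of \<open>k\<close>.\<close>
    have eq: "2 * n * (b k - b (k - 1)) = (k * (k + 1) + 2 * n - 2) * d 0
        + (2 * k + 2 + 2 * (k - 1) * (2 * n - k - 1)) * d 1
        + ((2 * n - k + 1) * (2 * n - k + 2) + 2 * n - 2) * d 2"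
      unfolding right_diff_distrib rec d_def by (simp add: algebra_simps)
    have d: "d 1 \<ge> 0" "d 2 \<ge> 0" using inc[of "k-1"] inc[of "k-2"] k by (auto simp: d_def)
    have "0 \<le> (2 * n - k + 1) * (2 * n - k + 2)" "0 \<le> (k - 1) * (2 * n - k - 1)"
      using k n False by auto
    moreover have "0 \<le> k * (k + 1)" using False by simp
    ultimately have c: "0 \<le> (2 * n - k + 1) * (2 * n - k + 2) + 2 * n - 2"
      "0 \<le> 2 * k + 2 + 2 * (k - 1) * (2 * n - k - 1)" "0 \<le> k * (k + 1) + 2 * n - 2"
      using n False unfolding mult.assoc by linarith+
    have "0 \<le> (k * (k + 1) + 2 * n - 2) * d 0
        + (2 * k + 2 + 2 * (k - 1) * (2 * n - k - 1)) * d 1"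
    proof (cases "k = n")
      case True
      have "a n = a (n - 2)" using sym[of n] by (simp add: algebra_simps)
      then have "d 0 = - d 1" by (simp add: d_def True)
      \<comment> \<open>This is what the first two summands become at \<open>k = n\<close> after
        substituting \<open>d 0 = - d 1\<close>. The product of the consecutive integers
        \<open>n - 3\<close> and \<open>n - 2\<close> is never negative.\<close>
      moreover have "0 \<le> (n - 2) * (n - 3) * d 1"
      proof (cases "n = 2")
        case False
        then show ?thesis using n d by simp
      qed simp
      ultimately show ?thesis by (simp add: True algebra_simps)
    next
      case False
      then have "d 0 \<ge> 0" using inc[of k] k by (simp add: d_def)
      then show ?thesis using d c by (intro add_nonneg_nonneg[OF mult_nonneg_nonneg mult_nonneg_nonneg])
    qed
    with eq c d have "0 \<le> 2 * n * (b k - b (k - 1))" by simp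
    then show ?thesis using n by (simp add: zero_le_mult_iff)
  qed
qed

text \<open>Zero at negative indices, so that the recurrence and the symmetry hold for all
  integers.\<close>

definition J_int :: "nat \<Rightarrow> int \<Rightarrow> int" where
  "J_int m k = (if k < 0 then 0 else int (J m (nat k)))"

lemma sum_J_int:
  assumes "n \<ge> 1"
  shows "(\<Sum>k<2*n. int (J (2 * n) k) * ncompat (2 * n) r k) = int ((r choose 2) + n - 1 choose n)"
  using arg_cong[OF sum_J[OF assms, of r], of int] by (simp add: ncompat_def)

lemma J_int_recurrence:
  assumes n: "n \<ge> 2"
  shows "2 * int n * J_int (2 * n) k =
       (k * (k + 1) + 2 * int n - 2) * J_int (2 * (n - 1)) k
     + 2 * ((k - 1) * (2 * int n - k - 1) + 1) * J_int (2 * (n - 1)) (k - 1)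
     + ((2 * int n - k) * (2 * int n - k + 1) + 2 * int n - 2) * J_int (2 * (n - 1)) (k - 2)"
  (is "_ = ?rhs k")
proof -
  define m where "m = 2 * n"
  define a where "a = J_int (2 * (n - 1))"
  define A where "A j = (j * (j + 1) + int m - 2) * a j" for j :: int
  define B where "B j = 2 * (j * (int m - j - 2) + 1) * a j" for j :: int
  define C where "C j = ((int m - j - 2) * (int m - j - 1) + int m - 2) * a j" for j :: int
  have a0: "a j = 0" if "j < 0 \<or> j \<ge> int m - 2" for j
    using that n by (auto simp: a_def J_int_def m_def intro: J_eq_0)
  have rhs: "?rhs k = A k + B (k - 1) + C (k - 2)" for k
    by (simp add: A_def B_def C_def a_def m_def algebra_simps)
  obtain q where q: "m = Suc (Suc q)" and q2: "2 * (n - 1) = q"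
    using n by (intro that[of "2 * (n - 1)"]) (simp_all add: m_def)
  have aq: "a = J_int q" by (simp only: a_def q2)
  have "(\<Sum>k<m. (int m * int (J m k)) * ncompat m r k) = (\<Sum>k<m. ?rhs (int k) * ncompat m r k)" for r
  proof -
    \<comment> \<open>With this \<open>s\<close> the right-hand sides for \<open>n\<close> and
      \<open>n - 1\<close> are \<open>Suc s choose n\<close> and \<open>s choose (n - 1)\<close>,
      which absorption relates.\<close>
    define s where "s = (r choose 2) + (n - 2)"
    have "2 * int (r choose 2) = int r * (int r - 1)"
      using arg_cong[OF Suc_times_binomial_eq[of "r - 1" 1], of int] by (cases r) (simp_all add: numeral_2_eq_2 algebra_simps)
    then have s: "2 * (int s + 1) = int r * (int r - 1) + int m - 2"
      using n by (simp add: s_def m_def of_nat_diff)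
    have e: "(r choose 2) + n - 1 = Suc s" "n = Suc (n - 1)" "(r choose 2) + (n - 1) - 1 = s"
      using n by (auto simp: s_def)
    have up: "(int s + 1) * int (s choose (n - 1)) = int n * int (Suc s choose n)"
      using arg_cong[OF Suc_times_binomial_eq[of s "n-1"], of int] unfolding e(2)[symmetric]
      by (simp add: algebra_simps)
    have "(\<Sum>k<m. (int m * int (J m k)) * ncompat m r k) = int m * int (Suc s choose n)"
      using sum_J_int[of n r] n unfolding e(1) m_def mult.assoc sum_distrib_left[symmetric] by simp
    also have "\<dots> = (int r * (int r - 1) + int m - 2) * int (s choose (n - 1))"
      unfolding s[symmetric] mult.assoc up by (simp add: m_def)
    also have "\<dots> = (int r * (int r - 1) + int m - 2) * (\<Sum>j<q. a (int j) * ncompat (m - 2) r j)"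
      using sum_J_int[of "n - 1" r, unfolded q2 e(3)] n by (simp add: q aq J_int_def)
    also have "\<dots> = (\<Sum>j<q. a (int j) * ((int r * (int r - 1) + int m - 2) * ncompat (m - 2) r j))"
      by (simp add: sum_distrib_left mult_ac)
    also have "\<dots> = (\<Sum>j<q. A (int j) * ncompat m r j + B (int j) * ncompat m r (j + 1) + C (int j) * ncompat m r (j + 2))"
    proof (intro sum.cong refl)
      fix j
      have m3: "m \<ge> 3" using n by (simp add: m_def)
      show "a (int j) * ((int r * (int r - 1) + int m - 2) * ncompat (m - 2) r j) =
        A (int j) * ncompat m r j + B (int j) * ncompat m r (j + 1) + C (int j) * ncompat m r (j + 2)"
        unfolding ncompat_recurrence[OF m3] A_def B_def C_def by (simp only: algebra_simps)
    qed
    also have "\<dots> = (\<Sum>j<q. A (int j) * ncompat m r j) + (\<Sum>j<q. B (int j) * ncompat m r (j + 1))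
        + (\<Sum>j<q. C (int j) * ncompat m r (j + 2))"
      by (simp add: sum.distrib)
    \<comment> \<open>All three sums are brought to the range \<open>k < m\<close> with
      \<open>m = q + 2\<close>; the added terms vanish by \<open>a0\<close>.\<close>
    also have "(\<Sum>j<q. A (int j) * ncompat m r j) = (\<Sum>k<m. A (int k) * ncompat m r k)"
      by (simp add: q A_def a0)
    also have "(\<Sum>j<q. B (int j) * ncompat m r (j + 1)) = (\<Sum>k<m. B (int k - 1) * ncompat m r k)"
      unfolding q by (subst sum.lessThan_Suc_shift) (simp add: q B_def a0)
    also have "(\<Sum>j<q. C (int j) * ncompat m r (j + 2)) = (\<Sum>k<m. C (int k - 2) * ncompat m r k)"
      unfolding q by (subst sum.lessThan_Suc_shift, subst sum.lessThan_Suc_shift) (simp add: q C_def a0)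
    also have "(\<Sum>k<m. A (int k) * ncompat m r k) + (\<Sum>k<m. B (int k - 1) * ncompat m r k)
        + (\<Sum>k<m. C (int k - 2) * ncompat m r k) = (\<Sum>k<m. ?rhs (int k) * ncompat m r k)"
      unfolding rhs by (simp add: sum.distrib distrib_right)
    finally show ?thesis .
  qed
  then have main: "int m * int (J m k) = ?rhs (int k)" if "k < m" for k
    using ncompat_unique[of m "\<lambda>k. int m * int (J m k)" m "\<lambda>k. ?rhs (int k)" k] that q by simp
  show ?thesis
  proof (cases "0 \<le> k \<and> k < int m")
    case True
    then obtain i where i: "k = int i" "i < m" by (metis nonneg_int_cases of_nat_less_iff)
    have "J_int (2 * n) k = int (J m i)" by (simp add: J_int_def i(1) m_def)
    moreover have "2 * int n = int m" by (simp add: m_def)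
    ultimately show ?thesis using main[OF i(2)] unfolding i(1) by (simp only:)
  next
    case False
    then consider "k < 0" | "int m \<le> k" by linarith
    \<comment> \<open>Outside \<open>0 \<le> k < m\<close> both sides vanish; for
      \<open>k \<ge> m\<close> even \<open>k - 2\<close> is at least \<open>m - 2\<close>, where
      \<open>a\<close> is zero.\<close>
    then have "a k = 0 \<and> a (k - 1) = 0 \<and> a (k - 2) = 0 \<and> J_int (2 * n) k = 0"
    proof cases
      case 1
      then show ?thesis using a0[of k] a0[of "k-1"] a0[of "k-2"] by (simp add: J_int_def)
    next
      case 2
      then have "J m (nat k) = 0" using q by (intro J_eq_0) linarith+
      then show ?thesis using 2 a0[of k] a0[of "k-1"] a0[of "k-2"] by (simp add: J_int_def flip: m_def)
    qed
    then show ?thesis by (simp add: a_def)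
  qed
qed

text \<open>For \<open>n = 1\<close> the right-hand side of the counting identity is
  \<open>r choose 2\<close>, which is \<open>ncompat 2 r 1\<close>.\<close>

lemma J_int_2: "J_int 2 k = (if k = 1 then 1 else 0)"
proof -
  have "(\<Sum>k<2. int (J 2 k) * ncompat 2 r k) = (\<Sum>k<2. (if k = 1 then 1 else 0) * ncompat 2 r k)" for r
    using sum_J_int[of 1 r] by (simp add: ncompat_def numeral_2_eq_2)
  then have "int (J 2 k) = (if k = 1 then 1 else 0)" if "k < 2" for k
    using ncompat_unique[of 2 "\<lambda>k. int (J 2 k)" 2 "\<lambda>k. if k = 1 then 1 else 0" k] that by simp
  then show ?thesis using J_eq_0[of 2 "nat k"] by (cases "k < 2") (auto simp: J_int_def nat_less_iff)
qed

lemma J_int_properties: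
  assumes "n \<ge> 1"
  shows "k \<le> 0 \<Longrightarrow> J_int (2 * n) k = 0"
    and "J_int (2 * n) (2 * int n - k) = J_int (2 * n) k"
    and "k \<le> int n \<Longrightarrow> J_int (2 * n) (k - 1) \<le> J_int (2 * n) k"
proof -
  have "(\<forall>k\<le>0. J_int (2 * n) k = 0) \<and> (\<forall>k. J_int (2 * n) (2 * int n - k) = J_int (2 * n) k) \<and>
    (\<forall>k\<le>int n. J_int (2 * n) (k - 1) \<le> J_int (2 * n) k)"
    using assms
  proof (induction n rule: dec_induct)
    case base
    show ?case by (auto simp: J_int_2)
  next
    case (step n)
    have n: "int (Suc n) \<ge> 2" "Suc n \<ge> 2" "int (Suc n) - 1 = int n" using step.hyps by auto
    note U = unimodal_step[of "int (Suc n)" "J_int (2 * Suc n)" "J_int (2 * n)", OF n(1) J_int_recurrence[OF n(2), simplified diff_Suc_1], unfolded n(3)]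
    show ?case using step.IH U by blast
  qed
  then show "k \<le> 0 \<Longrightarrow> J_int (2 * n) k = 0"
    and "J_int (2 * n) (2 * int n - k) = J_int (2 * n) k"
    and "k \<le> int n \<Longrightarrow> J_int (2 * n) (k - 1) \<le> J_int (2 * n) k" by auto
qed

theorem theorem3p2:
  fixes n :: nat
  assumes "n \<ge> 1"
  shows "\<exists>j\<in>{1..2*n-1}.
           (\<forall>i\<in>{1..j}. \<forall>i'\<in>{1..j}. i \<le> i' \<longrightarrow> J (2*n) i \<le> J (2*n) i') \<and>
           (\<forall>i\<in>{j..2*n-1}. \<forall>i'\<in>{j..2*n-1}. i \<le> i' \<longrightarrow> J (2*n) i' \<le> J (2*n) i)"
proof -
  have inc: "J (2 * n) i \<le> J (2 * n) i'" if "i \<le> i'" "i' \<le> n" for i i'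
    using that
  proof (induction rule: dec_induct)
    case (step k)
    have "J (2 * n) k \<le> J (2 * n) (Suc k)"
      using J_int_properties(3)[OF assms, of "int (Suc k)"] step by (simp add: J_int_def nat_add_distrib)
    then show ?case using step by simp
  qed simp
  have sym: "J (2 * n) (2 * n - i) = J (2 * n) i" if "i \<le> 2 * n" for i
    using J_int_properties(2)[OF assms, of "int i"] that by (simp add: J_int_def nat_diff_distrib nat_mult_distrib)
  have dec: "J (2 * n) i' \<le> J (2 * n) i" if "n \<le> i" "i \<le> i'" "i' \<le> 2 * n" for i i'
    using inc[of "2 * n - i'" "2 * n - i"] sym[of i] sym[of i'] that by simp
  \<comment> \<open>The peak is the centre of symmetry \<open>n\<close>.\<close>
  show ?thesis
    by (intro bexI[of _ n]) (use assms inc dec in auto)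
qed

end
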